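(* For all $L\in\mathbb{N}$ and $k\in\mathbb{N}$, the sum $$h(L,k)=\sum_{j=-L}^{2L}(-1)^j q^{\frac{j(3j+1)}{2}+kj}\begin{bmatrix}2L-j\\ L+j\end{bmatrix}$$ has the value $$h(L,k)=\sum_{j=0}^{k}q^{\binom{j+1}{2}}q^{jL}\begin{bmatrix}k\\ j\end{bmatrix}(-1)^j\,w(-k-j)=\sum_{j=0}^{k}q^{\binom{j+1}{2}}q^{jL}\begin{bmatrix}k\\ j\end{bmatrix}(-1)^j\,w(k+j+1).$$
   Context: Here $q$ is an indeterminate and identities are in the field $\mathbb{Q}(q)$; $\mathbb{N}=\{0,1,2,\dots\}$. For integers $n,k\ge 0$ the $q$-binomial coefficient is $\begin{bmatrix}n\\k\end{bmatrix}=\frac{(1-q^{n-k+1})\cdots(1-q^n)}{(1-q)\cdots(1-q^k)}$ (so it equals $1$ for $k=0$ and $0$ for $k>n$). The function $w$ is defined on all integers $n\in\mathbb{Z}$ by $w(n)=0$ if $n\equiv 2\pmod 3$ and $w(n)=(-1)^{\lfloor n/3\rfloor}q^{-\frac{n(n-1)}{6}}$ otherwise; equivalently, for all $m\in\mathbb{Z}$, $w(3m)=(-1)^m q^{-\frac{m(3m-1)}{2}}$, $w(3m+1)=(-1)^m q^{-\frac{m(3m+1)}{2}}$, $w(3m+2)=0$. *)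

theory Defs
  imports "HOL-Computational_Algebra.Computational_Algebra"
begin

type_synonym ratfun = "rat poly fract"

definition q :: ratfun where
  "q = to_fract [:0, 1:]"

text \<open>
  The exponents are computed in the integers: truncated subtraction \<^term>\<open>n - k :: nat\<close>
  would destroy the vanishing for \<^term>\<open>k > (n :: nat)\<close>.
\<close>
definition qbinom :: "nat \<Rightarrow> nat \<Rightarrow> ratfun" where
  "qbinom n k =
     (\<Prod>i=1..k. 1 - q powi (int n - int k + int i)) / (\<Prod>i=1..k. 1 - q ^ i)"

text \<open>The divisions by 6 here and by 2 below are exact.\<close>
definition w :: "int \<Rightarrow> ratfun" where
  "w n = (if n mod 3 = 2 then 0
          else (-1) powi (n div 3) * q powi (- (n * (n - 1) div 6)))"

text \<open>Both conversions to \<^typ>\<open>nat\<close> are applied to nonnegative integers in the range of summation.\<close>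
definition h :: "nat \<Rightarrow> nat \<Rightarrow> ratfun" where
  "h L k = (\<Sum>j = - int L..2 * int L.
     (-1) powi j * q powi (j * (3 * j + 1) div 2 + int k * j)
       * qbinom (nat (2 * int L - j)) (nat (int L + j)))"

lemma w_3m: "w (3 * m) = (-1) powi m * q powi (- (m * (3 * m - 1) div 2))"
proof -
  have "3 * m * (3 * m - 1) div 6 = (3 * (m * (3 * m - 1))) div (3 * 2)"
    by (simp add: algebra_simps)
  also have "\<dots> = m * (3 * m - 1) div 2"
    by (rule div_mult_mult1) simp
  finally show ?thesis by (simp add: w_def)
qed

lemma w_3m_plus_1: "w (3 * m + 1) = (-1) powi m * q powi (- (m * (3 * m + 1) div 2))"
proof -
  have "(3 * m + 1) * (3 * m + 1 - 1) div 6 = (3 * (m * (3 * m + 1))) div (3 * 2)"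
    by (simp add: algebra_simps)
  also have "\<dots> = m * (3 * m + 1) div 2"
    by (rule div_mult_mult1) simp
  finally have e: "(3 * m + 1) * (3 * m + 1 - 1) div 6 = m * (3 * m + 1) div 2" .
  have "(3 * m + 1) mod 3 = 1" "(3 * m + 1) div 3 = m" by presburger+
  then show ?thesis by (simp only: w_def e) simp
qed

lemma w_3m_plus_2: "w (3 * m + 2) = 0"
proof -
  have "(3 * m + 2) mod 3 = 2" by presburger
  then show ?thesis by (simp add: w_def)
qed

end

theory Submission imports Defs begin

text \<open>
  The sum \<open>h L k\<close> is the member \<open>(3 * L, k - 3 * L)\<close>, up to a power of \<open>q\<close> and a sign, of the
  two-parameter family
  \[ f(s,c) = \sum_j (-1)^j q^{j(3j+1)/2 + cj} {s-j \brack j} , \]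
  called \<open>pent_sum\<close> below: substituting \<open>j - L\<close> for \<open>j\<close> turns the entries \<open>2L - j\<close> and \<open>L + j\<close>
  into \<open>3L - j\<close> and \<open>j\<close>, and changes \<open>j(3j+1)/2\<close> only by a linear term (\<open>h_eq_pent_sum\<close>).

  In this family the two \<open>q\<close>-Pascal rules become two recurrences that lower \<open>s\<close>:
  \[ f(s,c) = f(s-1,c+1) - q^{c+2} f(s-2,c+3), \qquad
     f(s,c) = f(s-1,c) - q^{s+c} f(s-2,c+1). \]
  The first one links the diagonal \<open>c = -s\<close> to the diagonal \<open>c = 1 - s\<close>, and the second one
  eliminates the latter; the resulting relation telescopes to
  \<open>f(s,-s) = -q^{2-s} f(s-3,3-s)\<close>. The function \<open>w\<close> has the same quasi-period \<open>3\<close> and the same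
  three initial values \<open>1, 1, 0\<close>, hence \<open>f(s,-s) = w(s)\<close> (\<open>pent_sum_diagonal\<close>).

  Put \<open>F(s,k) = f(s,k-s)\<close>. The first recurrence, solved for its last term, reads
  \[ F(s,k+1) = q^{s-k} (F(s+1,k) - F(s+2,k)) . \]
  It goes from \<open>k\<close> to \<open>k + 1\<close> for all \<open>s\<close> at once and only looks at larger \<open>s\<close>, so that it never
  meets the boundary \<open>s < 0\<close>, where \<open>w\<close> need not vanish but the sums are empty. After the
  factor \<open>q^{sk}\<close> is taken out, it is the shift operator \<open>E\<close> times \<open>1 - q^k E\<close>, and expanding
  \<open>E^k (1 - E) (1 - q E) ... (1 - q^{k-1} E)\<close> by the \<open>q\<close>-binomial theorem gives
  \[ F(s,k) = q^{sk} \sum_j (-1)^j q^{\binom{j}{2}} {k \brack j} w(s+k+j) \]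
  (\<open>pent_sum_closed_form\<close>). For \<open>s = 3L\<close>, reversing this sum and removing multiples of \<open>3\<close> from the
  argument of \<open>w\<close> gives the first formula; the second one follows by the reflection
  \<open>w(1 - n) = w(n)\<close>.
\<close>

section \<open>Recurrences of the q-binomial coefficients\<close>

lemma q_neq_0 [simp]: "q \<noteq> 0"
  by (simp add: q_def)

text \<open>
  This is where \<^const>\<open>q\<close> has to be an indeterminate: it makes the denominators of the
  \<open>q\<close>-binomial coefficients nonzero.
\<close>
lemma q_power_eq_1_iff [simp]: "q ^ m = 1 \<longleftrightarrow> m = 0"
proof
  assume "q ^ m = 1"
  moreover have "q ^ m = to_fract (monom 1 m)"
    by (induction m) (simp_all add: q_def monom_Suc flip: to_fract_mult)
  ultimately have "to_fract (monom 1 m) = to_fract (1 :: rat poly)"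
    by simp
  then have "degree (monom (1 :: rat) m) = degree (1 :: rat poly)"
    by (simp only: to_fract_eq_iff)
  then show "m = 0" by (simp add: degree_monom_eq)
qed simp

lemma qbinom_0 [simp]: "qbinom n 0 = 1"
  by (simp add: qbinom_def)

lemma qbinom_eq_0: "n < k \<Longrightarrow> qbinom n k = 0"
  unfolding qbinom_def
  \<comment> \<open>The factor with index \<open>k - n\<close> is \<open>1 - q ^ 0\<close>.\<close>
  by (auto intro!: bexI [of _ "k - n"])

lemma one_minus_q_power_neq_0: "1 - q ^ Suc k \<noteq> 0"
  using q_power_eq_1_iff [of "Suc k"] by (metis eq_iff_diff_eq_0 nat.distinct(1))

lemma qbinom_denominator_neq_0: "(\<Prod>i=1..k. 1 - q ^ i) \<noteq> 0"
proof -
  have "1 - q ^ i \<noteq> 0" if "i \<in> {1..k}" for i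
    using that one_minus_q_power_neq_0 [of "i - 1"] by simp
  then show ?thesis by (simp only: prod_zero_iff finite_atLeastAtMost) blast
qed

lemma qbinom_mult_denominator:
  "qbinom n k * (\<Prod>i=1..k. 1 - q ^ i) = (\<Prod>i=1..k. 1 - q powi (int n - int k + int i))"
  unfolding qbinom_def using qbinom_denominator_neq_0 by simp

text \<open>
  In this relation and the next, both sides are one product up to an index shift: the factors
  of the numerator differ only at one end. The two Pascal rules are linear combinations of them.
\<close>
lemma qbinom_Suc_Suc: "qbinom (Suc n) (Suc k) * (1 - q ^ Suc k) = qbinom n k * (1 - q ^ Suc n)"
proof -
  define D where "D k = (\<Prod>i=1..k. 1 - q ^ i)" for k
  have D: "D (Suc k) = D k * (1 - q ^ Suc k)" by (simp add: D_def)
  have "qbinom (Suc n) (Suc k) * (1 - q ^ Suc k) * D k = qbinom (Suc n) (Suc k) * D (Suc k)"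
    unfolding D by (simp only: mult_ac)
  also have "\<dots> = (\<Prod>i=1..k. 1 - q powi (int n - int k + int i)) * (1 - q powi int (Suc n))"
    unfolding D_def qbinom_mult_denominator by (simp add: add.commute [of 1])
  also have "\<dots> = qbinom n k * (1 - q ^ Suc n) * D k"
    unfolding power_int_of_nat qbinom_mult_denominator [symmetric] D_def by (simp only: mult_ac)
  finally show ?thesis
    using qbinom_denominator_neq_0 [of k] unfolding D_def by (metis mult_right_cancel)
qed

lemma qbinom_Suc_right:
  "qbinom n (Suc k) * (1 - q ^ Suc k) = qbinom n k * (1 - q powi (int n - int k))"
proof -
  define D where "D k = (\<Prod>i=1..k. 1 - q ^ i)" for k
  have D: "D (Suc k) = D k * (1 - q ^ Suc k)" by (simp add: D_def)
  have "qbinom n (Suc k) * (1 - q ^ Suc k) * D k = qbinom n (Suc k) * D (Suc k)"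
    unfolding D by (simp only: mult_ac)
  also have "\<dots> = (\<Prod>i=Suc 0..Suc k. 1 - q powi (int n - int (Suc k) + int i))"
    unfolding D_def qbinom_mult_denominator by simp
  also have "\<dots> = (\<Prod>i=0..k. 1 - q powi (int n - int k + int i))"
    unfolding prod.shift_bounds_cl_Suc_ivl by (simp add: algebra_simps)
  also have "\<dots> = (1 - q powi (int n - int k)) * (\<Prod>i=1..k. 1 - q powi (int n - int k + int i))"
    by (subst prod.atLeast_Suc_atMost) simp_all
  also have "\<dots> = qbinom n k * (1 - q powi (int n - int k)) * D k"
    unfolding qbinom_mult_denominator [symmetric] D_def by (simp only: mult_ac)
  finally show ?thesis
    using qbinom_denominator_neq_0 [of k] unfolding D_def by (metis mult_right_cancel)
qed

lemma q_power_diff_mult: "q powi (int n - int k) * q ^ Suc k = q ^ Suc n"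
  by (simp add: power_int_diff)

lemma qbinom_pascal1:
  "qbinom (Suc n) (Suc k) = q powi (int n - int k) * qbinom n k + qbinom n (Suc k)"
proof -
  define a where "a = q powi (int n - int k)"
  have "qbinom (Suc n) (Suc k) * (1 - q ^ Suc k) = qbinom n k * (1 - a * q ^ Suc k)"
    unfolding qbinom_Suc_Suc a_def q_power_diff_mult ..
  also have "\<dots> = a * qbinom n k * (1 - q ^ Suc k) + qbinom n k * (1 - a)"
    by (simp only: algebra_simps)
  also have "qbinom n k * (1 - a) = qbinom n (Suc k) * (1 - q ^ Suc k)"
    unfolding a_def qbinom_Suc_right ..
  finally have "qbinom (Suc n) (Suc k) * (1 - q ^ Suc k)
      = (a * qbinom n k + qbinom n (Suc k)) * (1 - q ^ Suc k)"
    by (simp only: distrib_right)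
  then show ?thesis
    using one_minus_q_power_neq_0 unfolding a_def by (metis mult_right_cancel)
qed

lemma qbinom_pascal2:
  "qbinom (Suc n) (Suc k) = qbinom n k + q ^ Suc k * qbinom n (Suc k)"
proof -
  define a where "a = q powi (int n - int k)"
  have "qbinom (Suc n) (Suc k) * (1 - q ^ Suc k) = qbinom n k * (1 - a * q ^ Suc k)"
    unfolding qbinom_Suc_Suc a_def q_power_diff_mult ..
  also have "\<dots> = qbinom n k * (1 - q ^ Suc k) + q ^ Suc k * (qbinom n k * (1 - a))"
    by (simp only: algebra_simps)
  also have "qbinom n k * (1 - a) = qbinom n (Suc k) * (1 - q ^ Suc k)"
    unfolding a_def qbinom_Suc_right ..
  finally have "qbinom (Suc n) (Suc k) * (1 - q ^ Suc k)
      = (qbinom n k + q ^ Suc k * qbinom n (Suc k)) * (1 - q ^ Suc k)"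
    by (simp only: distrib_right mult.assoc)
  then show ?thesis
    using one_minus_q_power_neq_0 by (metis mult_right_cancel)
qed

lemma qbinom_self [simp]: "qbinom n n = 1"
  by (induction n) (simp_all add: qbinom_pascal1 qbinom_eq_0 del: power_Suc)

lemma qbinom_symmetric: "k \<le> n \<Longrightarrow> qbinom n (n - k) = qbinom n k"
proof (induction n arbitrary: k)
  case (Suc n)
  show ?case
  proof (cases "k = 0 \<or> k = Suc n")
    case False
    then obtain i where k: "k = Suc i" and i: "i < n" using Suc.prems by (cases k) auto
    define m where "m = n - Suc i"
    have m: "Suc n - k = Suc m" "n - i = Suc m" "n - Suc i = m" "int n - int i = int (Suc m)"
      using i k by (auto simp: m_def)
    have "qbinom (Suc n) (Suc m) = qbinom n m + q ^ Suc m * qbinom n (Suc m)"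
      by (rule qbinom_pascal2)
    also have "\<dots> = qbinom n (Suc i) + q ^ Suc m * qbinom n i"
      using Suc.IH [of i] Suc.IH [of "Suc i"] i by (simp add: m)
    also have "\<dots> = qbinom (Suc n) (Suc i)"
      by (simp only: qbinom_pascal1 m power_int_of_nat add.commute)
    finally show ?thesis by (simp add: m k)
  qed auto
qed simp

section \<open>Quasi-periodicity and reflection of w\<close>

lemma two_pentagonal: "2 * (j * (3 * j + 1) div 2) = j * (3 * j + 1)" for j :: int
  by (rule dvd_mult_div_cancel) simp

text \<open>
  The exponent of \<^const>\<open>w\<close> is quadratic, so that a shift of the argument by a multiple of \<open>3\<close> costs
  only a factor whose exponent is linear in \<open>n\<close>.
\<close>
lemma w_add_3m:
  "w (n + 3 * m) = (-1) powi m * q powi (- (n * m + m * (3 * m - 1) div 2)) * w n"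
proof -
  have d: "2 * (m * (3 * m - 1) div 2) = m * (3 * m - 1)"
    by (rule dvd_mult_div_cancel) simp
  have "(n + 3 * m) * (n + 3 * m - 1) = n * (n - 1) + 6 * (n * m) + 3 * (m * (3 * m - 1))"
    by (simp add: algebra_simps)
  also have "\<dots> = n * (n - 1) + 6 * (n * m + m * (3 * m - 1) div 2)"
    using d by simp
  finally have "(n + 3 * m) * (n + 3 * m - 1) div 6
      = n * (n - 1) div 6 + (n * m + m * (3 * m - 1) div 2)"
    by simp
  moreover have "(n + 3 * m) mod 3 = n mod 3" "(n + 3 * m) div 3 = n div 3 + m"
    by simp_all
  ultimately show ?thesis
    by (simp add: w_def power_int_add power_int_diff power_int_minus divide_simps)
qed

text \<open>
  The map \<open>n \<mapsto> 1 - n\<close> exchanges the residues \<open>0\<close> and \<open>1\<close> modulo \<open>3\<close>, fixes the residue \<open>2\<close>, and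
  preserves \<open>n (n - 1)\<close>.
\<close>
lemma w_reflect: "w (1 - n) = w n"
proof -
  have e: "(1 - n) * (1 - n - 1) = n * (n - 1)" by (simp add: algebra_simps)
  have "n = 3 * (n div 3) \<or> n = 3 * (n div 3) + 1 \<or> n = 3 * (n div 3) + 2"
    by presburger
  then consider m where "n = 3 * m" | m where "n = 3 * m + 1" | m where "n = 3 * m + 2"
    by blast
  then show ?thesis
  proof cases
    case 1
    then have "(1 - n) mod 3 = 1" "(1 - n) div 3 = - m" "n mod 3 = 0" "n div 3 = m" by presburger+
    then show ?thesis unfolding w_def e by (simp add: power_int_minus flip: power_int_inverse)
  next
    case 2
    then have "(1 - n) mod 3 = 0" "(1 - n) div 3 = - m" "n mod 3 = 1" "n div 3 = m" by presburger+
    then show ?thesis unfolding w_def e by (simp add: power_int_minus flip: power_int_inverse)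
  next
    case 3
    then have "(1 - n) mod 3 = 2" "n mod 3 = 2" by presburger+
    then show ?thesis by (simp add: w_def)
  qed
qed

section \<open>An alternating sum with pentagonal exponents\<close>

lemma pentagonal_Suc:
  "int (Suc j) * (3 * int (Suc j) + 1) div 2 = int j * (3 * int j + 1) div 2 + 3 * int j + 2"
  using two_pentagonal [of "int j"] two_pentagonal [of "int (Suc j)"]
  by (simp add: algebra_simps)

definition pent_weight :: "int \<Rightarrow> nat \<Rightarrow> ratfun" where
  "pent_weight c j = (-1) ^ j * q powi (int j * (3 * int j + 1) div 2 + c * int j)"

lemma pent_weight_0 [simp]: "pent_weight c 0 = 1"
  by (simp add: pent_weight_def)

text \<open>
  The successive differences of \<open>j (3 j + 1) / 2\<close> are linear with slope \<open>3\<close>. Hence an index shift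
  of the sum raises \<open>c\<close> by \<open>3\<close>.
\<close>
lemma pent_weight_Suc: "pent_weight c (Suc j) = - (q powi (c + 2)) * pent_weight (c + 3) j"
  unfolding pent_weight_def pentagonal_Suc by (simp add: algebra_simps flip: power_int_add)

lemma pent_weight_add: "pent_weight (c + d) j = pent_weight c j * q powi (d * int j)"
  unfolding pent_weight_def by (simp add: algebra_simps flip: power_int_add)

text \<open>
  The terms with \<open>2 j > s\<close> vanish, so that any upper limit from \<open>s / 2\<close> on gives the same sum; with
  truncated subtraction this remains true beyond \<open>j = s\<close>, where the coefficient is that of \<open>0\<close>
  over \<open>j\<close>.
\<close>
definition pent_sum :: "nat \<Rightarrow> int \<Rightarrow> ratfun" where
  "pent_sum s c = (\<Sum>j\<le>s. pent_weight c j * qbinom (s - j) j)"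

lemma pent_sum_0 [simp]: "pent_sum 0 c = 1"
  by (simp add: pent_sum_def)

lemma pent_sum_1 [simp]: "pent_sum (Suc 0) c = 1"
  by (simp add: pent_sum_def qbinom_eq_0)

lemma pent_sum_extend:
  assumes "s \<le> n"
  shows "pent_sum s c = (\<Sum>j\<le>n. pent_weight c j * qbinom (s - j) j)"
  unfolding pent_sum_def using assms by (intro sum.mono_neutral_left) (auto simp: qbinom_eq_0)

lemma pent_sum_Suc:
  assumes "s \<le> n"
  shows "pent_sum (Suc s) c = 1 + (\<Sum>j\<le>n. pent_weight c (Suc j) * qbinom (s - j) (Suc j))"
  using assms by (simp add: pent_sum_extend [of "Suc s" "Suc n"] sum.atMost_Suc_shift del: sum.atMost_Suc)

text \<open>
  Pascal's rule splits the coefficient of \<open>s + 2 - j\<close> over \<open>j\<close>. The part with unchanged lower entry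
  carries a factor \<open>q ^ j\<close>, which raises \<open>c\<close> by \<open>1\<close>; the other part is shifted by one index, which
  raises \<open>c\<close> by \<open>3\<close>.
\<close>
lemma pent_sum_rec_pascal2:
  "pent_sum (s + 2) c = pent_sum (s + 1) (c + 1) - q powi (c + 2) * pent_sum s (c + 3)"
proof -
  have step: "pent_weight c (Suc j) * qbinom (Suc s - j) (Suc j)
      = pent_weight (c + 1) (Suc j) * qbinom (s - j) (Suc j)
        - q powi (c + 2) * (pent_weight (c + 3) j * qbinom (s - j) j)" for j
  proof (cases "j \<le> s")
    case True
    have "pent_weight c (Suc j) * qbinom (Suc s - j) (Suc j)
        = pent_weight c (Suc j) * qbinom (s - j) j
          + (pent_weight c (Suc j) * q ^ Suc j) * qbinom (s - j) (Suc j)"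
      using True by (simp only: Suc_diff_le qbinom_pascal2 distrib_left mult.assoc)
    also have "pent_weight c (Suc j) * q ^ Suc j = pent_weight (c + 1) (Suc j)"
      unfolding pent_weight_add mult_1 power_int_of_nat ..
    finally show ?thesis unfolding pent_weight_Suc [of c] by simp
  qed (simp add: qbinom_eq_0)
  have "pent_sum (s + 2) c = 1 + (\<Sum>j\<le>Suc s. pent_weight c (Suc j) * qbinom (Suc s - j) (Suc j))"
    using pent_sum_Suc [of "Suc s" "Suc s" c] by simp
  also have "\<dots> = 1 + (\<Sum>j\<le>Suc s. pent_weight (c + 1) (Suc j) * qbinom (s - j) (Suc j))
      - q powi (c + 2) * (\<Sum>j\<le>Suc s. pent_weight (c + 3) j * qbinom (s - j) j)"
    unfolding step sum_subtractf sum_distrib_left by simp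
  also have "\<dots> = pent_sum (s + 1) (c + 1) - q powi (c + 2) * pent_sum s (c + 3)"
    using pent_sum_Suc [of s "Suc s" "c + 1"] pent_sum_extend [of s "Suc s" "c + 3"] by simp
  finally show ?thesis .
qed

text \<open>
  The other Pascal rule puts a power of \<open>q\<close> on the shifted part instead. Its exponent decreases
  by \<open>2\<close> when the index grows by \<open>1\<close>, so that the rise of \<open>c\<close> by \<open>3\<close> is reduced to \<open>1\<close>.
\<close>
lemma pent_sum_rec_pascal1:
  "pent_sum (s + 2) c = pent_sum (s + 1) c - q powi (int s + 2 + c) * pent_sum s (c + 1)"
proof -
  have step: "pent_weight c (Suc j) * qbinom (Suc s - j) (Suc j)
      = pent_weight c (Suc j) * qbinom (s - j) (Suc j)
        - q powi (int s + 2 + c) * (pent_weight (c + 1) j * qbinom (s - j) j)" for j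
  proof (cases "j \<le> s")
    case True
    have "pent_weight c (Suc j) * q powi (int (s - j) - int j)
        = - (pent_weight (c + 1) j * (q powi (2 * int j) * q powi (c + 2) * q powi (int (s - j) - int j)))"
      using pent_weight_add [of "c + 1" 2 j] unfolding pent_weight_Suc by (simp add: algebra_simps)
    also have "q powi (2 * int j) * q powi (c + 2) * q powi (int (s - j) - int j) = q powi (int s + 2 + c)"
      using True by (simp add: of_nat_diff algebra_simps flip: power_int_add)
    finally have e: "pent_weight c (Suc j) * q powi (int (s - j) - int j)
        = - (pent_weight (c + 1) j * q powi (int s + 2 + c))" .
    have "pent_weight c (Suc j) * qbinom (Suc s - j) (Suc j)
        = (pent_weight c (Suc j) * q powi (int (s - j) - int j)) * qbinom (s - j) j
          + pent_weight c (Suc j) * qbinom (s - j) (Suc j)"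
      using True by (simp only: Suc_diff_le qbinom_pascal1 distrib_left mult.assoc)
    then show ?thesis unfolding e by simp
  qed (simp add: qbinom_eq_0)
  have "pent_sum (s + 2) c = 1 + (\<Sum>j\<le>Suc s. pent_weight c (Suc j) * qbinom (Suc s - j) (Suc j))"
    using pent_sum_Suc [of "Suc s" "Suc s" c] by simp
  also have "\<dots> = 1 + (\<Sum>j\<le>Suc s. pent_weight c (Suc j) * qbinom (s - j) (Suc j))
      - q powi (int s + 2 + c) * (\<Sum>j\<le>Suc s. pent_weight (c + 1) j * qbinom (s - j) j)"
    unfolding step sum_subtractf sum_distrib_left by simp
  also have "\<dots> = pent_sum (s + 1) c - q powi (int s + 2 + c) * pent_sum s (c + 1)"
    using pent_sum_Suc [of s "Suc s" c] pent_sum_extend [of s "Suc s" "c + 1"] by simp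
  finally show ?thesis .
qed

text \<open>
  Eliminating the neighbouring diagonal from the two recurrences gives, for \<open>u s\<close> the value at
  \<open>(s, -s)\<close>, the relation \<open>u (s + 4) + q^{-s-2} u (s + 1) = u (s + 3) + q^{-s-1} u s\<close>. So the quantity
  that is claimed to be zero does not change with \<open>s\<close>.
\<close>
lemma pent_sum_diagonal_add_3:
  "pent_sum (s + 3) (- int (s + 3)) = - (q powi (- int s - 1)) * pent_sum s (- int s)"
proof (induction s)
  case 0
  have "pent_sum (1 + 2) (- 3) = - inverse q"
    using pent_sum_rec_pascal1 [of 1 "-3"] pent_sum_rec_pascal1 [of 0 "-3"] by (simp add: power_int_minus)
  then show ?case by (simp add: numeral_3_eq_3 power_int_minus)
next
  case (Suc s)
  have a: "pent_sum (s + 4) (- int (s + 4)) = pent_sum (s + 3) (- int (s + 3)) - q powi (- int s - 2) * pent_sum (s + 2) (- int (s + 1))"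
  proof -
    have "- int (s + 4) + 2 = - int s - 2" "- int (s + 4) + 1 = - int (s + 3)"
      "- int (s + 4) + 3 = - int (s + 1)" "s + 2 + 2 = s + 4" "s + 2 + 1 = s + 3" by simp_all
    then show ?thesis using pent_sum_rec_pascal2 [of "s + 2" "- int (s + 4)"] by (simp only:)
  qed
  have b: "pent_sum (s + 2) (- int (s + 1)) = pent_sum (s + 1) (- int (s + 1)) - q * pent_sum s (- int s)"
    using pent_sum_rec_pascal1 [of s "- int (s + 1)"] by simp
  have c: "q powi (- int s - 2) * q = q powi (- int s - 1)"
  proof -
    have "- int s - 1 = (- int s - 2) + 1" by simp
    then show ?thesis by (simp only: power_int_add_1 q_neq_0 simp_thms)
  qed
  have "pent_sum (s + 4) (- int (s + 4)) = - (q powi (- int s - 2)) * pent_sum (s + 1) (- int (s + 1))"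
    unfolding a b Suc.IH c [symmetric] by (simp add: algebra_simps)
  moreover have "- int (Suc s) - 1 = - int s - 2" "Suc s + 3 = s + 4" "s + 1 = Suc s" by simp_all
  ultimately show ?case by (simp only:)
qed

lemma pent_sum_diagonal: "pent_sum s (- int s) = w (int s)"
proof (induction s rule: less_induct)
  case (less s)
  consider "s = 0" | "s = 1" | "s = 2" | t where "s = t + 3"
    by (metis add.commute less_2_cases_iff less_Suc_eq linorder_not_less numeral_2_eq_2 numeral_3_eq_3 le_iff_add One_nat_def)
  then show ?case
  proof cases
    case 3
    then show ?thesis using pent_sum_rec_pascal1 [of 0 "-2"] by (simp add: w_def numeral_2_eq_2)
  next
    case (4 t)
    then show ?thesis
      using less.IH [of t] pent_sum_diagonal_add_3 [of t] w_add_3m [of "int t" 1] by simp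
  qed (simp_all add: w_def)
qed

section \<open>Evaluation off the diagonal\<close>

lemma Suc_choose_2: "Suc j choose 2 = j + (j choose 2)"
  by (simp add: numeral_2_eq_2)

text \<open>
  Multiplication of \<open>(1 - E) (1 - q E) ... (1 - q^{k-1} E)\<close> by \<open>1 - q^k E\<close>, for the shift operator
  \<open>E\<close> acting on sequences, with the products expanded by the \<open>q\<close>-binomial theorem.
\<close>
lemma qbinom_alternating_sum_Suc:
  fixes v :: "nat \<Rightarrow> ratfun"
  shows "(\<Sum>j\<le>Suc k. (-1) ^ j * q ^ (j choose 2) * qbinom (Suc k) j * v j)
       = (\<Sum>j\<le>k. (-1) ^ j * q ^ (j choose 2) * qbinom k j * v j)
         - q ^ k * (\<Sum>j\<le>k. (-1) ^ j * q ^ (j choose 2) * qbinom k j * v (Suc j))"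
proof -
  have step: "(-1) ^ Suc j * q ^ (Suc j choose 2) * qbinom (Suc k) (Suc j) * v (Suc j)
      = (-1) ^ Suc j * q ^ (Suc j choose 2) * qbinom k (Suc j) * v (Suc j)
        - q ^ k * ((-1) ^ j * q ^ (j choose 2) * qbinom k j * v (Suc j))" if "j \<le> k" for j
  proof -
    have "q ^ (Suc j choose 2) * q powi (int k - int j) = q ^ (j choose 2) * q ^ k"
      unfolding Suc_choose_2 power_int_of_nat [symmetric] power_int_add [OF disjI1, OF q_neq_0, symmetric]
      by simp
    then show ?thesis unfolding qbinom_pascal1 by (simp add: algebra_simps)
  qed
  have "(\<Sum>j\<le>Suc k. (-1) ^ j * q ^ (j choose 2) * qbinom (Suc k) j * v j)
      = v 0 + (\<Sum>j\<le>k. (-1) ^ Suc j * q ^ (Suc j choose 2) * qbinom (Suc k) (Suc j) * v (Suc j))"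
    by (simp add: sum.atMost_Suc_shift numeral_2_eq_2 del: sum.atMost_Suc power_Suc)
  also have "\<dots> = v 0 + (\<Sum>j\<le>k. (-1) ^ Suc j * q ^ (Suc j choose 2) * qbinom k (Suc j) * v (Suc j))
      - q ^ k * (\<Sum>j\<le>k. (-1) ^ j * q ^ (j choose 2) * qbinom k j * v (Suc j))"
    using step by (simp add: sum_subtractf sum_distrib_left del: power_Suc)
  also have "v 0 + (\<Sum>j\<le>k. (-1) ^ Suc j * q ^ (Suc j choose 2) * qbinom k (Suc j) * v (Suc j))
      = (\<Sum>j\<le>Suc k. (-1) ^ j * q ^ (j choose 2) * qbinom k j * v j)"
    by (simp add: sum.atMost_Suc_shift numeral_2_eq_2 del: sum.atMost_Suc power_Suc)
  also have "\<dots> = (\<Sum>j\<le>k. (-1) ^ j * q ^ (j choose 2) * qbinom k j * v j)"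
    by (simp add: qbinom_eq_0)
  finally show ?thesis .
qed

text \<open>
  The recurrence of \<open>pent_sum_rec_pascal2\<close> is read upwards: it expresses the value at \<open>(s, k + 1 - s)\<close>
  by those at \<open>(s + 1, k - (s + 1))\<close> and \<open>(s + 2, k - (s + 2))\<close>. Therefore the induction on \<open>k\<close> needs
  the statement for all \<open>s\<close>.
\<close>
lemma pent_sum_closed_form:
  "pent_sum s (int k - int s) = q ^ (s * k)
     * (\<Sum>j\<le>k. (-1) ^ j * q ^ (j choose 2) * qbinom k j * w (int s + int k + int j))"
proof (induction k arbitrary: s)
  case 0
  show ?case by (simp add: pent_sum_diagonal numeral_2_eq_2)
next
  case (Suc k)
  define v where "v j = w (int s + int k + 1 + int j)" for j
  define A where "A = (\<Sum>j\<le>k. (-1) ^ j * q ^ (j choose 2) * qbinom k j * v j)"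
  define B where "B = (\<Sum>j\<le>k. (-1) ^ j * q ^ (j choose 2) * qbinom k j * v (Suc j))"
  have 1: "pent_sum (s + 1) (int k - int s - 1) = q ^ ((s + 1) * k) * A"
    using Suc.IH [of "s + 1"] by (simp add: A_def v_def algebra_simps)
  have 2: "pent_sum (s + 2) (int k - int s - 2) = q ^ ((s + 2) * k) * B"
    using Suc.IH [of "s + 2"] by (simp add: B_def v_def algebra_simps)
  have "pent_sum (s + 2) (int k - int s - 2)
      = pent_sum (s + 1) (int k - int s - 1) - q powi (int k - int s) * pent_sum s (int (Suc k) - int s)"
    using pent_sum_rec_pascal2 [of s "int k - int s - 2"] by (simp add: algebra_simps)
  then have "q ^ k * pent_sum s (int (Suc k) - int s) = q ^ s * (q ^ ((s + 1) * k) * A - q ^ ((s + 2) * k) * B)"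
    unfolding 1 2 by (simp add: power_int_diff field_simps)
  also have "\<dots> = q ^ k * (q ^ (s * Suc k) * (A - q ^ k * B))"
    by (simp add: power_add algebra_simps mult_2_right)
  finally have "pent_sum s (int (Suc k) - int s) = q ^ (s * Suc k) * (A - q ^ k * B)"
    by simp
  also have "A - q ^ k * B
      = (\<Sum>j\<le>Suc k. (-1) ^ j * q ^ (j choose 2) * qbinom (Suc k) j * v j)"
    unfolding A_def B_def by (rule qbinom_alternating_sum_Suc [symmetric])
  finally show ?case by (simp add: v_def algebra_simps)
qed

lemma h_eq_pent_sum:
  "h L k = (-1) powi int L * q powi (int L * (3 * int L - 1) div 2 - int k * int L)
     * pent_sum (3 * L) (int k - 3 * int L)"
proof -
  have dL: "2 * (int L * (3 * int L - 1) div 2) = int L * (3 * int L - 1)"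
    by (rule dvd_mult_div_cancel) simp
  have term_eq: "(-1) powi (int i - int L)
        * q powi ((int i - int L) * (3 * (int i - int L) + 1) div 2 + int k * (int i - int L))
      = (-1) powi int L * q powi (int L * (3 * int L - 1) div 2 - int k * int L)
        * pent_weight (int k - 3 * int L) i" for i
  proof -
    define A B C where "A = (int i - int L) * (3 * (int i - int L) + 1) div 2"
      and "B = int L * (3 * int L - 1) div 2" and "C = int i * (3 * int i + 1) div 2"
    have "2 * A = (int i - int L) * (3 * (int i - int L) + 1)"
      "2 * B = int L * (3 * int L - 1)" "2 * C = int i * (3 * int i + 1)"
      unfolding A_def B_def C_def by (rule two_pentagonal dL)+
    then have "A + int k * (int i - int L)
        = (B - int k * int L) + (C + (int k - 3 * int L) * int i)"
      by (simp add: algebra_simps)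
    then have "q powi (A + int k * (int i - int L))
        = q powi (B - int k * int L) * q powi (C + (int k - 3 * int L) * int i)"
      by (simp only: power_int_add q_neq_0 simp_thms)
    moreover have "(-1 :: ratfun) powi (int i - int L) = (-1) powi int L * (-1) ^ i"
      by (simp add: power_int_diff field_simps)
    ultimately show ?thesis by (simp add: pent_weight_def A_def B_def C_def)
  qed
  have "h L k = (\<Sum>i\<le>3 * L. (-1) powi (int i - int L)
        * q powi ((int i - int L) * (3 * (int i - int L) + 1) div 2 + int k * (int i - int L))
        * qbinom (3 * L - i) i)"
    unfolding h_def
    by (rule sum.reindex_bij_witness [of _ "\<lambda>i. int i - int L" "\<lambda>j. nat (int L + j)"])
       (auto simp: nat_diff_distrib algebra_simps intro!: arg_cong2 [where f = qbinom])
  also have "\<dots> = (-1) powi int L * q powi (int L * (3 * int L - 1) div 2 - int k * int L)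
     * pent_sum (3 * L) (int k - 3 * int L)"
    unfolding term_eq pent_sum_def sum_distrib_left by (simp add: mult.assoc)
  finally show ?thesis .
qed

theorem theorem1:
  fixes L k :: nat
  shows "h L k = (\<Sum>j=0..k. q ^ ((j + 1) choose 2) * q ^ (j * L) * qbinom k j * (-1) ^ j
                       * w (- int k - int j))
       \<and> h L k = (\<Sum>j=0..k. q ^ ((j + 1) choose 2) * q ^ (j * L) * qbinom k j * (-1) ^ j
                       * w (int k + int j + 1))"
proof -
  \<comment> \<open>the exponent in the shift of \<^const>\<open>w\<close> by \<open>3 * m\<close>\<close>
  define p where "p m = m * (3 * m - 1) div 2" for m :: int
  have p: "2 * p m = m * (3 * m - 1)" for m
    unfolding p_def by (rule dvd_mult_div_cancel) simp
  have tri: "2 * int (n choose 2) = int n * (int n - 1)" for n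
    by (induction n) (simp_all add: Suc_choose_2 algebra_simps numeral_2_eq_2)
  have "h L k = (-1) powi int L * q powi (p (int L) - int k * int L) * (q ^ (3 * L * k)
     * (\<Sum>j\<le>k. (-1) ^ j * q ^ (j choose 2) * qbinom k j * w (3 * int L + int k + int j)))"
    unfolding h_eq_pent_sum p_def using pent_sum_closed_form [of "3 * L" k] by simp
  \<comment> \<open>In reversed order the argument of \<^const>\<open>w\<close> is \<open>-k-j\<close> plus a multiple of \<open>3\<close>.\<close>
  also have "\<dots> = (-1) powi int L * q powi (p (int L) - int k * int L) * (q ^ (3 * L * k)
     * (\<Sum>j\<le>k. (-1) ^ (k - j) * q ^ ((k - j) choose 2) * qbinom k j * w (3 * int L + int k + int (k - j))))"
    by (intro arg_cong2 [where f = times] refl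
          sum.reindex_bij_witness [of _ "\<lambda>j. k - j" "\<lambda>j. k - j"])
       (auto simp: qbinom_symmetric)
  also have "\<dots> = (\<Sum>j\<le>k. q ^ ((j + 1) choose 2) * q ^ (j * L) * qbinom k j * (-1) ^ j
                       * w (- int k - int j))"
    unfolding sum_distrib_left
  proof (rule sum.cong [OF refl])
    fix j assume "j \<in> {..k}"
    then have jk: "j \<le> k" by simp
    define a where "a = p (int L) - int k * int L"
    define b where "b = - ((- int k - int j) * (int L + int k) + p (int L + int k))"
    have "w (3 * int L + int k + int (k - j)) = w ((- int k - int j) + 3 * (int L + int k))"
      using jk by (simp add: of_nat_diff algebra_simps)
    then have w: "w (3 * int L + int k + int (k - j))
        = (-1) ^ (L + k) * q powi b * w (- int k - int j)"
      unfolding w_add_3m b_def p_def by (simp flip: of_nat_add)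
    \<comment> \<open>The exponents are compared after doubling, which makes them polynomials.\<close>
    have "2 * (a + int (3 * L * k) + int ((k - j) choose 2) + b)
        = 2 * (int ((j + 1) choose 2) + int (j * L))"
      unfolding distrib_left tri a_def b_def right_diff_distrib minus_mult_right [symmetric] p
      using jk by (simp add: of_nat_diff algebra_simps)
    then have "a + int (3 * L * k) + int ((k - j) choose 2) + b
        = int ((j + 1) choose 2) + int (j * L)"
      by (simp only: mult_cancel_left) simp
    then have "q powi (a + int (3 * L * k) + int ((k - j) choose 2) + b)
        = q powi (int ((j + 1) choose 2) + int (j * L))"
      by (simp only:)
    then have e: "q powi a * q ^ (3 * L * k) * q ^ ((k - j) choose 2) * q powi b
        = q ^ ((j + 1) choose 2) * q ^ (j * L)"
      by (simp only: power_int_add q_neq_0 simp_thms power_int_of_nat)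
    have "(-1 :: ratfun) ^ L * (-1) ^ (k - j) * (-1) ^ (L + k) = (-1) ^ (L + (k - j) + (L + k))"
      by (simp only: power_add)
    also have "L + (k - j) + (L + k) = 2 * (L + (k - j)) + j"
      using jk by simp
    also have "(-1 :: ratfun) ^ \<dots> = (-1) ^ j"
      by (simp only: power_add power_mult) simp
    finally have s: "(-1 :: ratfun) ^ L * (-1) ^ (k - j) * (-1) ^ (L + k) = (-1) ^ j" .
    have "(-1) powi int L * q powi a * (q ^ (3 * L * k)
        * ((-1) ^ (k - j) * q ^ ((k - j) choose 2) * qbinom k j * w (3 * int L + int k + int (k - j))))
      = ((-1) ^ L * (-1) ^ (k - j) * (-1) ^ (L + k))
        * (q powi a * q ^ (3 * L * k) * q ^ ((k - j) choose 2) * q powi b)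
        * qbinom k j * w (- int k - int j)"
      unfolding w power_int_of_nat by (simp only: mult_ac)
    also have "\<dots> = q ^ ((j + 1) choose 2) * q ^ (j * L) * qbinom k j * (-1) ^ j
        * w (- int k - int j)"
      unfolding s e by (simp only: mult_ac)
    finally show "(-1) powi int L * q powi (p (int L) - int k * int L) * (q ^ (3 * L * k)
        * ((-1) ^ (k - j) * q ^ ((k - j) choose 2) * qbinom k j * w (3 * int L + int k + int (k - j))))
      = q ^ ((j + 1) choose 2) * q ^ (j * L) * qbinom k j * (-1) ^ j * w (- int k - int j)"
      unfolding a_def .
  qed
  finally have "h L k = (\<Sum>j=0..k. q ^ ((j + 1) choose 2) * q ^ (j * L) * qbinom k j * (-1) ^ j
                       * w (- int k - int j))"
    by (simp add: atLeast0AtMost)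
  moreover have "w (- int k - int j) = w (int k + int j + 1)" for j
  proof -
    have "- int k - int j = 1 - (int k + int j + 1)" by simp
    then show ?thesis by (simp only: w_reflect)
  qed
  ultimately show ?thesis by simp
qed

end
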